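(* Let $m\in\mathbb{N}$, $m\ge1$, let $A\subseteq\mathbb{N}^m$ be a finite nonempty downward closed set, let $n=\max_{\alpha\in A}\max_{1\le i\le m}\alpha_i$, and for $i=1,\dots,m$ let $P_i=\{p_{0,i},\dots,p_{n_i,i}\}\subseteq[-1,1]$ consist of $n_i+1$ distinct points with $n_i\ge\max_{\alpha\in A}\alpha_i$. Let $Q(x)=\sum_{\alpha\in A}c_\alpha N_\alpha(x)\in\Pi_A$, $c_\alpha\in\mathbb{R}$, be a polynomial given in the associated multivariate Newton basis, and let $x_0\in\mathbb{R}^m$. Then: (i) there is a recursive algorithm requiring $\mathcal{O}(|A|)$ operations and $\mathcal{O}(|A|)$ storage to evaluate $Q$ at $x_0$; (ii) there is an iterative algorithm requiring $\mathcal{O}(m|A|)$ operations and $\mathcal{O}(|A|)$ storage to evaluate $Q$ at $x_0$; (iii) there is an iterative algorithm requiring $\mathcal{O}(nm|A|)$ operations and $\mathcal{O}(|A|)$ storage to evaluate the partial derivative $\partial_{x_j}Q$, $1\le j\le m$, at $x_0$.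
   Context: $\mathbb{N}$ includes $0$. A set $A\subseteq\mathbb{N}^m$ is downward closed if $\alpha\in A$ and $\beta\in\mathbb{N}^m$ with $\beta_i\le\alpha_i$ for all $i$ imply $\beta\in A$. $\Pi_A=\mathrm{span}_{\mathbb{R}}\{x^\alpha:\alpha\in A\}$. The multivariate Newton polynomials are $N_\alpha(x)=\prod_{i=1}^m\prod_{j=0}^{\alpha_i-1}(x_i-p_{j,i})$, $\alpha\in A$ (empty products equal $1$). The input of the algorithms is $A$, the nodes $p_{j,i}$, the coefficients $c_\alpha$ and the point $x_0$. Operations are arithmetic operations on real numbers and storage is the number of real numbers stored. *)

theory Defs
  imports "HOL-Analysis.Analysis"
begin

section \<open>Newton polynomials on downward closed index sets\<close>

text \<open>
  Coordinates are numbered from \<open>0\<close> to \<open>m - 1\<close>. A multi-index in \<open>m\<close> variables is a function on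
  the naturals that vanishes from \<open>m\<close> on, so distinct functions are distinct multi-indices. A point
  is any real sequence, of which only the first \<open>m\<close> entries matter. The node \<open>p j i\<close> is the \<open>j\<close>-th
  node of coordinate \<open>i\<close>.
\<close>

type_synonym mindex = "nat \<Rightarrow> nat"
type_synonym point = "nat \<Rightarrow> real"

definition mindices :: "nat \<Rightarrow> mindex set" where
  "mindices m = {\<alpha>. \<forall>i\<ge>m. \<alpha> i = 0}"

definition downward_closed :: "nat \<Rightarrow> mindex set \<Rightarrow> bool" where
  "downward_closed m A \<longleftrightarrow>
     A \<subseteq> mindices m \<and> (\<forall>\<alpha>\<in>A. \<forall>\<beta>\<in>mindices m. (\<forall>i<m. \<beta> i \<le> \<alpha> i) \<longrightarrow> \<beta> \<in> A)"

definition poly_space :: "nat \<Rightarrow> mindex set \<Rightarrow> (point \<Rightarrow> real) set" where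
  "poly_space m A = {\<lambda>x. \<Sum>\<alpha>\<in>A. b \<alpha> * (\<Prod>i<m. x i ^ \<alpha> i) | b. True}"

definition newton_poly :: "nat \<Rightarrow> (nat \<Rightarrow> nat \<Rightarrow> real) \<Rightarrow> mindex \<Rightarrow> point \<Rightarrow> real" where
  "newton_poly m p \<alpha> x = (\<Prod>i<m. \<Prod>j<\<alpha> i. x i - p j i)"

definition max_degree :: "nat \<Rightarrow> mindex set \<Rightarrow> nat" where
  "max_degree m A = Max {\<alpha> i | \<alpha> i. \<alpha> \<in> A \<and> i < m}"

definition newton_setting ::
    "nat \<Rightarrow> mindex set \<Rightarrow> (nat \<Rightarrow> nat) \<Rightarrow> (nat \<Rightarrow> nat \<Rightarrow> real) \<Rightarrow> bool" where
  "newton_setting m A ns p \<longleftrightarrow>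
     m \<ge> 1 \<and> finite A \<and> A \<noteq> {} \<and> downward_closed m A \<and>
     (\<forall>i<m. Max ((\<lambda>\<alpha>. \<alpha> i) ` A) \<le> ns i \<and>
            inj_on (\<lambda>j. p j i) {..ns i} \<and> (\<lambda>j. p j i) ` {..ns i} \<subseteq> {-1..1})"

definition newton_form ::
    "nat \<Rightarrow> mindex set \<Rightarrow> (nat \<Rightarrow> nat \<Rightarrow> real) \<Rightarrow> (mindex \<Rightarrow> real) \<Rightarrow> (point \<Rightarrow> real) \<Rightarrow> bool" where
  "newton_form m A p c Q \<longleftrightarrow>
     Q \<in> poly_space m A \<and> Q = (\<lambda>x. \<Sum>\<alpha>\<in>A. c \<alpha> * newton_poly m p \<alpha> x)"

definition partial_deriv :: "nat \<Rightarrow> (point \<Rightarrow> real) \<Rightarrow> point \<Rightarrow> real" where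
  "partial_deriv j f x = deriv (\<lambda>t. f (x(j := t))) (x j)"


section \<open>Algorithms over the reals\<close>

text \<open>
  A small imperative language. The discrete variables, numbered by naturals, each hold a sequence of
  naturals, which serves as a multi-index or, through its entry \<open>0\<close>, as a counter. Real numbers are
  kept in memory cells, addressed by an array number and a multi-index. Discrete and real data do
  not mix: tests inspect discrete data only, and no expression turns naturals into reals or reals
  into naturals. The input is read-only.
\<close>

record input =
  dim :: nat
  idx :: "mindex list"    \<comment> \<open>the index set, enumerated in some order\<close>
  node :: "nat \<Rightarrow> nat \<Rightarrow> real"
  coef :: "mindex \<Rightarrow> real"
  pt :: point

datatype nexp =
    Num nat
  | Entry nat nexp
  | Dim
  | Card
  | Plus nexp nexp
  | Minus nexp nexp

datatype bexp =
    Less nexp nexp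
  | Member nat
  | Not bexp
  | And bexp bexp

datatype operand =
    Lit int
  | Coef nat
  | Point nexp
  | Node nexp nexp
  | Cell nat nat          \<comment> \<open>\<open>Cell a d\<close>: array \<open>a\<close> at the multi-index held by variable \<open>d\<close>\<close>

datatype aop = Add | Sub | Mul | Div

datatype com =
    Skip
  | Set nat nexp nexp     \<comment> \<open>\<open>Set d e f\<close>: entry \<open>e\<close> of variable \<open>d\<close> becomes \<open>f\<close>\<close>
  | Pick nat nexp         \<comment> \<open>\<open>Pick d e\<close>: \<open>d\<close> becomes the multi-index at position \<open>e\<close> of the enumeration\<close>
  | Move nat nat operand
  | Arith nat nat aop operand operand
  | Seq com com
  | If bexp com com
  | While bexp com
  | Call                  \<comment> \<open>run the whole program on a copy of the discrete variables\<close>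

type_synonym dvars = "nat \<Rightarrow> nat \<Rightarrow> nat"
type_synonym cell = "nat \<times> mindex"

record state =
  dvars :: dvars
  mem :: "cell \<Rightarrow> real"
  ops :: nat              \<comment> \<open>arithmetic operations performed so far\<close>
  used :: "cell set"      \<comment> \<open>memory cells written so far; they are never given back\<close>

fun nval :: "input \<Rightarrow> dvars \<Rightarrow> nexp \<Rightarrow> nat" where
  "nval I D (Num k) = k"
| "nval I D (Entry d e) = D d (nval I D e)"
| "nval I D Dim = dim I"
| "nval I D Card = length (idx I)"
| "nval I D (Plus e f) = nval I D e + nval I D f"
| "nval I D (Minus e f) = nval I D e - nval I D f"

fun bval :: "input \<Rightarrow> dvars \<Rightarrow> bexp \<Rightarrow> bool" where
  "bval I D (Less e f) = (nval I D e < nval I D f)"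
| "bval I D (Member d) = (D d \<in> set (idx I))"
| "bval I D (Not b) = (\<not> bval I D b)"
| "bval I D (And b b') = (bval I D b \<and> bval I D b')"

fun rval :: "input \<Rightarrow> state \<Rightarrow> operand \<Rightarrow> real" where
  "rval I s (Lit k) = of_int k"
| "rval I s (Coef d) = coef I (dvars s d)"
| "rval I s (Point e) = pt I (nval I (dvars s) e)"
| "rval I s (Node e f) = node I (nval I (dvars s) e) (nval I (dvars s) f)"
| "rval I s (Cell a d) = mem s (a, dvars s d)"

fun arith :: "aop \<Rightarrow> real \<Rightarrow> real \<Rightarrow> real" where
  "arith Add x y = x + y"
| "arith Sub x y = x - y"
| "arith Mul x y = x * y"
| "arith Div x y = x / y"

definition store :: "cell \<Rightarrow> real \<Rightarrow> state \<Rightarrow> state" where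
  "store l r s = s\<lparr>mem := (mem s)(l := r), used := insert l (used s)\<rparr>"

text \<open>
  Big-step semantics of a command within the program \<open>P\<close>. The real memory is global; the discrete
  variables are local to each call. Picking beyond the enumeration and dividing by zero have no
  successor state.
\<close>

inductive exec :: "input \<Rightarrow> com \<Rightarrow> com \<Rightarrow> state \<Rightarrow> state \<Rightarrow> bool" for I P where
  Skip: "exec I P Skip s s"
| Set: "exec I P (Set d e f) s
     (s\<lparr>dvars := (dvars s)(d := (dvars s d)(nval I (dvars s) e := nval I (dvars s) f))\<rparr>)"
| Pick: "nval I (dvars s) e < length (idx I) \<Longrightarrow>
     exec I P (Pick d e) s (s\<lparr>dvars := (dvars s)(d := idx I ! nval I (dvars s) e)\<rparr>)"
| Move: "exec I P (Move a d u) s (store (a, dvars s d) (rval I s u) s)"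
| Arith: "(g = Div \<longrightarrow> rval I s v \<noteq> 0) \<Longrightarrow>
     exec I P (Arith a d g u v) s
       (store (a, dvars s d) (arith g (rval I s u) (rval I s v)) (s\<lparr>ops := Suc (ops s)\<rparr>))"
| Seq: "exec I P c s s' \<Longrightarrow> exec I P c' s' s'' \<Longrightarrow> exec I P (Seq c c') s s''"
| IfTrue: "bval I (dvars s) b \<Longrightarrow> exec I P c s s' \<Longrightarrow> exec I P (If b c c') s s'"
| IfFalse: "\<not> bval I (dvars s) b \<Longrightarrow> exec I P c' s s' \<Longrightarrow> exec I P (If b c c') s s'"
| WhileFalse: "\<not> bval I (dvars s) b \<Longrightarrow> exec I P (While b c) s s"
| WhileTrue: "bval I (dvars s) b \<Longrightarrow> exec I P c s s' \<Longrightarrow> exec I P (While b c) s' s'' \<Longrightarrow>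
     exec I P (While b c) s s''"
| Call: "exec I P P s s' \<Longrightarrow> exec I P Call s (s'\<lparr>dvars := dvars s\<rparr>)"

inductive_cases exec_elims:
  "exec I P Skip s t" "exec I P (Set d e f) s t" "exec I P (Pick d e) s t"
  "exec I P (Move a d u) s t" "exec I P (Arith a d g u v) s t" "exec I P (Seq c c') s t"
  "exec I P (If b c c') s t" "exec I P (While b c) s t" "exec I P Call s t"

lemma exec_deterministic: "exec I P c s s' \<Longrightarrow> exec I P c s s'' \<Longrightarrow> s'' = s'"
proof (induction arbitrary: s'' rule: exec.induct)
  case Skip
  then show ?case by (rule exec_elims(1))
next
  case Set
  then show ?case by (rule exec_elims(2))
next
  case Pick
  from Pick.prems show ?case by (rule exec_elims(3))
next
  case Move
  then show ?case by (rule exec_elims(4))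
next
  case Arith
  from Arith.prems show ?case by (rule exec_elims(5))
next
  case Seq
  from Seq.prems show ?case by (rule exec_elims(6)) (use Seq.IH in blast)
next
  case IfTrue
  from IfTrue.prems show ?case by (rule exec_elims(7)) (use IfTrue.hyps IfTrue.IH in blast)+
next
  case IfFalse
  from IfFalse.prems show ?case by (rule exec_elims(7)) (use IfFalse.hyps IfFalse.IH in blast)+
next
  case WhileFalse
  from WhileFalse.prems show ?case by (rule exec_elims(8)) (use WhileFalse.hyps in blast)+
next
  case WhileTrue
  from WhileTrue.prems show ?case
    by (rule exec_elims(8)) (use WhileTrue.hyps WhileTrue.IH in blast)+
next
  case Call
  from Call.prems show ?case by (rule exec_elims(9)) (use Call.IH in blast)
qed

fun has_call :: "com \<Rightarrow> bool" where
  "has_call Call = True"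
| "has_call (Seq c c') = (has_call c \<or> has_call c')"
| "has_call (If b c c') = (has_call c \<or> has_call c')"
| "has_call (While b c) = has_call c"
| "has_call _ = False"

fun has_while :: "com \<Rightarrow> bool" where
  "has_while (While b c) = True"
| "has_while (Seq c c') = (has_while c \<or> has_while c')"
| "has_while (If b c c') = (has_while c \<or> has_while c')"
| "has_while _ = False"

definition recursive_alg :: "com \<Rightarrow> bool" where
  "recursive_alg P \<longleftrightarrow> has_call P \<and> \<not> has_while P"

definition iterative_alg :: "com \<Rightarrow> bool" where
  "iterative_alg P \<longleftrightarrow> has_while P \<and> \<not> has_call P"

text \<open>
  The list \<open>args\<close> of further discrete inputs is placed in variable \<open>0\<close>. The real memory starts with
  arbitrary contents, so cells that have not been written hold no usable numbers. The output is
  found in array \<open>0\<close> at the zero multi-index.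
\<close>

definition start :: "nat list \<Rightarrow> (cell \<Rightarrow> real) \<Rightarrow> state" where
  "start args M =
     \<lparr>dvars = (\<lambda>d i. if d = 0 \<and> i < length args then args ! i else 0),
      mem = M, ops = 0, used = {}\<rparr>"

definition computes_within :: "com \<Rightarrow> input \<Rightarrow> nat list \<Rightarrow> real \<Rightarrow> nat \<Rightarrow> nat \<Rightarrow> bool" where
  "computes_within P I args y T S \<longleftrightarrow>
     (\<forall>M. \<exists>s. exec I P P (start args M) s \<and> mem s (0, \<lambda>_. 0) = y \<and>
              ops s \<le> T \<and> card (used s) \<le> S)"

text \<open>
  Valid inputs for the index set \<open>A\<close>; the order in which \<open>A\<close> is enumerated is left open.
\<close>

definition newton_input ::
    "nat \<Rightarrow> mindex set \<Rightarrow> (nat \<Rightarrow> nat \<Rightarrow> real) \<Rightarrow> (mindex \<Rightarrow> real) \<Rightarrow> point \<Rightarrow> input \<Rightarrow> bool" where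
  "newton_input m A p c x I \<longleftrightarrow>
     (\<exists>as. distinct as \<and> set as = A \<and> I = \<lparr>dim = m, idx = as, node = p, coef = c, pt = x\<rparr>)"

end

theory Submission
  imports Defs
begin

text \<open>
  All three algorithms rest on one generalisation of Horner's rule. For \<open>\<alpha> \<in> A\<close> and \<open>i \<le> m\<close> let
  \<open>horner i \<alpha>\<close> be the sum of the polynomials \<open>c \<beta> * N \<beta> / N \<alpha>\<close> over those \<open>\<beta> \<in> A\<close> that dominate
  \<open>\<alpha>\<close> in the coordinates below \<open>i\<close> and agree with \<open>\<alpha>\<close> in the others. Then \<open>horner 0 \<alpha> = c \<alpha>\<close> and
  \<open>horner m 0 = Q\<close>. Splitting the sum according to whether \<open>\<beta> i = \<alpha> i\<close> or \<open>\<beta> i > \<alpha> i\<close> gives (lemma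
  \<open>horner_Suc\<close>) \<open>horner (i + 1) \<alpha> = horner i \<alpha> + (x i - p (\<alpha> i) i) * horner (i + 1) (\<alpha> + e i)\<close>,
  where \<open>e i\<close> is the unit multi-index; the last summand vanishes if \<open>\<alpha> + e i \<notin> A\<close>, because \<open>A\<close> is
  downward closed. Differentiating in coordinate \<open>j\<close> yields a recurrence of the same shape for the
  partial derivatives, with the additional term \<open>horner (i + 1) (\<alpha> + e i)\<close> when \<open>i = j\<close>.

  The recursive algorithm evaluates the recurrence literally, skipping the second summand if \<open>\<alpha> +
  e i \<notin> A\<close>. Otherwise the two recursive calls work on the two disjoint parts of the index set over
  which the sum was split, and each combination of their results costs three operations. By
  induction the call for \<open>(i, \<alpha>)\<close> performs at most \<open>3 * (k - 1)\<close> operations, where \<open>k\<close> is the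
  number of indices that it sums over (lemma \<open>wp_horner_rec\<close>). At the top these indices are all of
  \<open>A\<close>, so the total is linear in the cardinality of \<open>A\<close>, whatever \<open>m\<close> is.

  The iterative algorithm keeps a table of \<open>horner i\<close> and one of its derivative, both indexed by
  \<open>A\<close>, and turns them into the tables for \<open>i + 1\<close> in place, going through the indices in the order
  of decreasing entry \<open>i\<close>, so that \<open>\<alpha> + e i\<close> is always finished before \<open>\<alpha>\<close>. One sweep updates
  every index at most once with at most six operations, and there are \<open>m\<close> sweeps (lemma
  \<open>wp_horner_iter\<close>). Searching the next index is work on discrete data only. An update needs some
  \<open>\<alpha> + e i \<in> A\<close>, hence the maximal degree is at least \<open>1\<close> whenever any operation is performed, and
  the bound with the factor \<open>n\<close> follows also in the degenerate case \<open>n = 0\<close>. The value of \<open>Q\<close> is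
  read off the first table and the partial derivative off the second; in fact both cost \<open>O(m *
  card A)\<close>.
\<close>

section \<open>A Horner scheme on downward closed sets\<close>

text \<open>
  The index set of the partial sums: coordinates below \<open>i\<close> have been summed out above \<open>\<alpha>\<close>, the
  remaining ones are still fixed.
\<close>

definition upper :: "mindex set \<Rightarrow> nat \<Rightarrow> mindex \<Rightarrow> mindex set" where
  "upper A i \<alpha> = {\<beta> \<in> A. (\<forall>k<i. \<alpha> k \<le> \<beta> k) \<and> (\<forall>k\<ge>i. \<beta> k = \<alpha> k)}"

text \<open>
  The product is the quotient of the Newton polynomials of \<open>\<beta>\<close> and \<open>\<alpha>\<close>, which agree in the
  coordinates from \<open>i\<close> on; writing it as a product avoids dividing by \<open>0\<close> at the nodes.
\<close>

definition horner ::
    "mindex set \<Rightarrow> (nat \<Rightarrow> nat \<Rightarrow> real) \<Rightarrow> (mindex \<Rightarrow> real) \<Rightarrow> nat \<Rightarrow> mindex \<Rightarrow> point \<Rightarrow> real" where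
  "horner A p c i \<alpha> x =
     (\<Sum>\<beta>\<in>upper A i \<alpha>. c \<beta> * (\<Prod>k<i. \<Prod>j\<in>{\<alpha> k..<\<beta> k}. x k - p j k))"

abbreviation next_index :: "nat \<Rightarrow> mindex \<Rightarrow> mindex" where
  "next_index i \<alpha> \<equiv> \<alpha>(i := Suc (\<alpha> i))"

lemma finite_upper: "finite A \<Longrightarrow> finite (upper A i \<alpha>)"
  by (simp add: upper_def)

lemma upper_refl: "\<alpha> \<in> A \<Longrightarrow> \<alpha> \<in> upper A i \<alpha>"
  by (simp add: upper_def)

lemma upper_0: "\<alpha> \<in> A \<Longrightarrow> upper A 0 \<alpha> = {\<alpha>}"
  by (auto simp: upper_def)

lemma upper_Suc: "upper A (Suc i) \<alpha> = upper A i \<alpha> \<union> upper A (Suc i) (next_index i \<alpha>)"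
proof (intro equalityI subsetI)
  fix \<beta>
  assume \<beta>: "\<beta> \<in> upper A (Suc i) \<alpha>"
  show "\<beta> \<in> upper A i \<alpha> \<union> upper A (Suc i) (next_index i \<alpha>)"
  proof (cases "\<beta> i = \<alpha> i")
    case True
    then have "\<beta> k = \<alpha> k" if "k \<ge> i" for k
      using \<beta> that by (cases "k = i") (simp_all add: upper_def)
    with \<beta> show ?thesis
      by (simp add: upper_def)
  next
    case False
    moreover have "\<alpha> i \<le> \<beta> i"
      using \<beta> by (simp add: upper_def)
    ultimately have "Suc (\<alpha> i) \<le> \<beta> i"
      by simp
    then show ?thesis
      using \<beta> by (simp add: upper_def)
  qed
next
  fix \<beta>
  assume "\<beta> \<in> upper A i \<alpha> \<union> upper A (Suc i) (next_index i \<alpha>)"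
  then show "\<beta> \<in> upper A (Suc i) \<alpha>"
    by (auto simp: upper_def less_Suc_eq split: if_splits)
qed

lemma upper_disjoint: "upper A i \<alpha> \<inter> upper A (Suc i) (next_index i \<alpha>) = {}"
  by (auto simp: upper_def)

text \<open>
  Everything in this set dominates \<open>\<alpha> + e i\<close>, so a single element would force \<open>\<alpha> + e i\<close> into \<open>A\<close>.
  This is where downward closedness makes the Horner scheme stop at the boundary of \<open>A\<close>.
\<close>

lemma upper_next_empty:
  assumes "downward_closed m A" "\<alpha> \<in> A" "i < m" "next_index i \<alpha> \<notin> A"
  shows "upper A (Suc i) (next_index i \<alpha>) = {}"
proof (rule ccontr)
  assume "upper A (Suc i) (next_index i \<alpha>) \<noteq> {}"
  then obtain \<beta> where \<beta>: "\<beta> \<in> upper A (Suc i) (next_index i \<alpha>)"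
    by blast
  then have "\<forall>k. next_index i \<alpha> k \<le> \<beta> k"
    unfolding upper_def by (metis (mono_tags, lifting) mem_Collect_eq not_less order_refl)
  moreover have "next_index i \<alpha> \<in> mindices m"
    using assms(1-3) by (auto simp: downward_closed_def mindices_def)
  ultimately show False
    using \<beta> assms(1,4) by (auto simp: downward_closed_def upper_def)
qed

lemma zero_in_downward_closed:
  assumes "downward_closed m A" "A \<noteq> {}"
  shows "(\<lambda>_. 0) \<in> A"
  using assms unfolding downward_closed_def mindices_def by fastforce

lemma upper_all:
  assumes "downward_closed m A"
  shows "upper A m (\<lambda>_. 0) = A"
  using assms by (auto simp: upper_def downward_closed_def mindices_def)

text \<open>
  The multi-indices obtained from \<open>\<alpha>\<close> by lowering entry \<open>i\<close> all lie in \<open>A\<close>. The bound lets a loop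
  over the levels of a coordinate run up to the cardinality of \<open>A\<close>, which a program can read off its
  input, instead of the maximal degree.
\<close>

lemma entry_less_card:
  assumes "downward_closed m A" "finite A" "\<alpha> \<in> A" "i < m"
  shows "\<alpha> i < card A"
proof -
  have "\<alpha>(i := v) \<in> A" if "v \<le> \<alpha> i" for v
  proof -
    have "\<alpha>(i := v) \<in> mindices m"
      using assms(1,3,4) by (auto simp: downward_closed_def mindices_def)
    moreover have "\<forall>k<m. (\<alpha>(i := v)) k \<le> \<alpha> k"
      using that by simp
    ultimately show ?thesis
      using assms(1,3) unfolding downward_closed_def by blast
  qed
  then have "(\<lambda>v. \<alpha>(i := v)) ` {..\<alpha> i} \<subseteq> A"
    by auto
  moreover have "inj_on (\<lambda>v. \<alpha>(i := v)) {..\<alpha> i}"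
    by (rule inj_onI) (metis fun_upd_same)
  ultimately have "card {..\<alpha> i} \<le> card A"
    by (metis assms(2) card_image card_mono)
  then show ?thesis
    by simp
qed

lemma horner_0: "\<alpha> \<in> A \<Longrightarrow> horner A p c 0 \<alpha> x = c \<alpha>"
  by (simp add: horner_def upper_0)

text \<open>
  The sum splits into the indices with \<open>\<beta> i = \<alpha> i\<close>, for which the product in coordinate \<open>i\<close> is empty,
  and those with \<open>\<beta> i > \<alpha> i\<close>, from whose product the factor \<open>j = \<alpha> i\<close> is pulled out.
\<close>

lemma horner_Suc:
  assumes "finite A"
  shows "horner A p c (Suc i) \<alpha> x =
    horner A p c i \<alpha> x + (x i - p (\<alpha> i) i) * horner A p c (Suc i) (next_index i \<alpha>) x"
proof -
  let ?f = "\<lambda>\<gamma> i \<beta>. c \<beta> * (\<Prod>k<i. \<Prod>j\<in>{\<gamma> k..<\<beta> k}. x k - p j k)"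
  have "horner A p c (Suc i) \<alpha> x =
      sum (?f \<alpha> (Suc i)) (upper A i \<alpha>) + sum (?f \<alpha> (Suc i)) (upper A (Suc i) (next_index i \<alpha>))"
    unfolding horner_def
    by (subst upper_Suc, rule sum.union_disjoint) (simp_all add: assms finite_upper upper_disjoint)
  moreover have "sum (?f \<alpha> (Suc i)) (upper A i \<alpha>) = horner A p c i \<alpha> x"
    unfolding horner_def by (rule sum.cong) (auto simp: upper_def)
  moreover
  have "?f \<alpha> (Suc i) \<beta> = (x i - p (\<alpha> i) i) * ?f (next_index i \<alpha>) (Suc i) \<beta>"
    if "\<beta> \<in> upper A (Suc i) (next_index i \<alpha>)" for \<beta>
  proof -
    have "\<alpha> i < \<beta> i"
      using that by (auto simp: upper_def Suc_le_eq)
    then show ?thesis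
      by (simp add: prod.atLeast_Suc_lessThan)
  qed
  then have "sum (?f \<alpha> (Suc i)) (upper A (Suc i) (next_index i \<alpha>)) =
      (x i - p (\<alpha> i) i) * horner A p c (Suc i) (next_index i \<alpha>) x"
    unfolding horner_def sum_distrib_left by (rule sum.cong[OF refl])
  ultimately show ?thesis
    by simp
qed

lemma horner_next_outside:
  assumes "downward_closed m A" "\<alpha> \<in> A" "i < m" "next_index i \<alpha> \<notin> A"
  shows "horner A p c (Suc i) (next_index i \<alpha>) x = 0"
  using upper_next_empty[OF assms] by (simp add: horner_def)

lemma horner_eq_newton_form:
  assumes "downward_closed m A" "newton_form m A p c Q"
  shows "Q = horner A p c m (\<lambda>_. 0)"
  using assms
  by (simp add: fun_eq_iff newton_form_def horner_def upper_all newton_poly_def lessThan_atLeast0)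

lemma field_differentiable_prod:
  assumes "\<And>k. k \<in> S \<Longrightarrow> f k field_differentiable at t"
  shows "(\<lambda>u. \<Prod>k\<in>S. f k u) field_differentiable at t"
proof -
  have "((\<lambda>u. \<Prod>k\<in>S. f k u) has_field_derivative
      (\<Sum>k\<in>S. deriv (f k) t * (\<Prod>l\<in>S - {k}. f l t))) (at t)"
    by (rule has_field_derivative_prod) (simp add: DERIV_deriv_iff_field_differentiable assms)
  then show ?thesis
    unfolding field_differentiable_def by blast
qed

lemma horner_field_differentiable:
  "(\<lambda>t. horner A p c i \<alpha> (x(j := t))) field_differentiable at t"
proof -
  have "(\<lambda>t. (x(j := t)) k - p l k) field_differentiable at t" for k l
    by (cases "k = j") (auto intro!: derivative_intros)
  then have "(\<lambda>t. \<Prod>k<i. \<Prod>l\<in>{\<alpha> k..<\<beta> k}. (x(j := t)) k - p l k) field_differentiable at t" for \<beta>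
    by (intro field_differentiable_prod)
  then show ?thesis
    unfolding horner_def
    by (intro field_differentiable_sum field_differentiable_mult field_differentiable_const)
qed

text \<open>
  The product rule applied to \<open>horner_Suc\<close>; the linear factor depends on coordinate \<open>j\<close> only if
  \<open>i = j\<close>.
\<close>

lemma partial_deriv_horner_Suc:
  assumes "finite A"
  shows "partial_deriv j (horner A p c (Suc i) \<alpha>) x =
    partial_deriv j (horner A p c i \<alpha>) x
    + (x i - p (\<alpha> i) i) * partial_deriv j (horner A p c (Suc i) (next_index i \<alpha>)) x
    + (if i = j then horner A p c (Suc i) (next_index i \<alpha>) x else 0)"
proof -
  let ?l = "\<lambda>t. (x(j := t)) i - p (\<alpha> i) i"
  let ?f = "\<lambda>t. horner A p c i \<alpha> (x(j := t))"
  let ?g = "\<lambda>t. horner A p c (Suc i) (next_index i \<alpha>) (x(j := t))"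
  have l: "(?l has_field_derivative (if i = j then 1 else 0)) (at (x j))"
    by (auto intro!: derivative_eq_intros)
  have f: "(?f has_field_derivative deriv ?f (x j)) (at (x j))"
    and g: "(?g has_field_derivative deriv ?g (x j)) (at (x j))"
    unfolding DERIV_deriv_iff_field_differentiable by (rule horner_field_differentiable)+
  have "deriv (\<lambda>t. ?f t + ?l t * ?g t) (x j) =
      deriv ?f (x j) + ((if i = j then 1 else 0) * ?g (x j) + deriv ?g (x j) * ?l (x j))"
    by (rule DERIV_imp_deriv[OF DERIV_add[OF f DERIV_mult[OF l g]]])
  then show ?thesis
    unfolding partial_deriv_def horner_Suc[OF assms, of p c i \<alpha>] by (simp add: mult.commute)
qed

text \<open>
  The part of the Newton setting that the recurrences use, read off from the input record. The order
  in which the index set is enumerated remains arbitrary.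
\<close>

locale newton_data =
  fixes I :: input
  assumes distinct: "distinct (idx I)"
    and downward_closed: "downward_closed (dim I) (set (idx I))"
    and nonempty: "idx I \<noteq> []"
begin

abbreviation "m \<equiv> dim I"
abbreviation "A \<equiv> set (idx I)"

definition val :: "nat \<Rightarrow> mindex \<Rightarrow> real" where
  "val i \<alpha> = horner A (node I) (coef I) i \<alpha> (pt I)"

definition slope :: "nat \<Rightarrow> nat \<Rightarrow> mindex \<Rightarrow> real" where
  "slope j i \<alpha> = partial_deriv j (horner A (node I) (coef I) i \<alpha>) (pt I)"

lemma zero_index: "(\<lambda>_. 0) \<in> A"
  using zero_in_downward_closed[OF downward_closed] nonempty by simp

lemma card_A: "card A = length (idx I)"
  by (rule distinct_card[OF distinct])

lemma val_0: "\<alpha> \<in> A \<Longrightarrow> val 0 \<alpha> = coef I \<alpha>"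
  by (simp add: val_def horner_0)

lemma val_Suc: "val (Suc i) \<alpha> =
    val i \<alpha> + (pt I i - node I (\<alpha> i) i) * val (Suc i) (next_index i \<alpha>)"
  unfolding val_def by (rule horner_Suc) simp

lemma val_next_outside:
  assumes "\<alpha> \<in> A" "i < m" "next_index i \<alpha> \<notin> A"
  shows "val (Suc i) (next_index i \<alpha>) = 0"
  unfolding val_def by (rule horner_next_outside[OF downward_closed assms])

lemma val_Suc_last:
  assumes "\<alpha> \<in> A" "i < m" "next_index i \<alpha> \<notin> A"
  shows "val (Suc i) \<alpha> = val i \<alpha>"
  using val_next_outside[OF assms] by (simp add: val_Suc[of i \<alpha>])

lemma slope_0: "\<alpha> \<in> A \<Longrightarrow> slope j 0 \<alpha> = 0"
  by (simp add: slope_def partial_deriv_def horner_0)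

lemma slope_Suc: "slope j (Suc i) \<alpha> =
    slope j i \<alpha> + (pt I i - node I (\<alpha> i) i) * slope j (Suc i) (next_index i \<alpha>)
    + (if i = j then val (Suc i) (next_index i \<alpha>) else 0)"
  unfolding val_def slope_def by (rule partial_deriv_horner_Suc) simp

lemma slope_Suc_last:
  assumes "\<alpha> \<in> A" "i < m" "next_index i \<alpha> \<notin> A"
  shows "slope j (Suc i) \<alpha> = slope j i \<alpha>"
proof -
  have "slope j (Suc i) (next_index i \<alpha>) = 0"
    unfolding slope_def partial_deriv_def horner_next_outside[OF downward_closed assms] by simp
  then show ?thesis
    using val_next_outside[OF assms] by (simp only: slope_Suc[of j i \<alpha>]) simp
qed

end

section \<open>Reasoning about terminating runs\<close>

text \<open>
  Total correctness, phrased as a weakest precondition: a run exists and ends well. For straight-line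
  code the rules below are equations, so the simplifier executes a program symbolically.
\<close>

definition wp :: "input \<Rightarrow> com \<Rightarrow> com \<Rightarrow> (state \<Rightarrow> bool) \<Rightarrow> state \<Rightarrow> bool" where
  "wp I P c Q s \<longleftrightarrow> (\<exists>t. exec I P c s t \<and> Q t)"

lemma wp_mono: "wp I P c Q s \<Longrightarrow> (\<And>t. Q t \<Longrightarrow> R t) \<Longrightarrow> wp I P c R s"
  by (auto simp: wp_def)

lemma wp_Skip: "wp I P Skip Q s = Q s"
  unfolding wp_def by (blast intro: exec.Skip elim: exec_elims(1))

lemma wp_Set:
  "wp I P (Set d e f) Q s =
     Q (s\<lparr>dvars := (dvars s)(d := (dvars s d)(nval I (dvars s) e := nval I (dvars s) f))\<rparr>)"
  unfolding wp_def by (blast intro: exec.Set elim: exec_elims(2))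

lemma wp_Pick:
  "wp I P (Pick d e) Q s = (nval I (dvars s) e < length (idx I) \<and>
     Q (s\<lparr>dvars := (dvars s)(d := idx I ! nval I (dvars s) e)\<rparr>))"
  unfolding wp_def by (blast intro: exec.Pick elim: exec_elims(3))

lemma wp_Move: "wp I P (Move a d u) Q s = Q (store (a, dvars s d) (rval I s u) s)"
  unfolding wp_def by (blast intro: exec.Move elim: exec_elims(4))

lemma wp_Arith:
  "wp I P (Arith a d g u v) Q s = ((g = Div \<longrightarrow> rval I s v \<noteq> 0) \<and>
     Q (store (a, dvars s d) (arith g (rval I s u) (rval I s v)) (s\<lparr>ops := Suc (ops s)\<rparr>)))"
  unfolding wp_def by (blast intro: exec.Arith elim: exec_elims(5))

lemma wp_Seq: "wp I P (Seq c c') Q s = wp I P c (wp I P c' Q) s"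
  unfolding wp_def by (blast intro: exec.Seq elim: exec_elims(6))

lemma wp_If:
  "wp I P (If b c c') Q s = (if bval I (dvars s) b then wp I P c Q s else wp I P c' Q s)"
  unfolding wp_def by (auto intro: exec.IfTrue exec.IfFalse elim: exec_elims(7))

lemma wp_Call: "wp I P Call Q s = wp I P P (\<lambda>t. Q (t\<lparr>dvars := dvars s\<rparr>)) s"
  unfolding wp_def by (metis exec.Call exec_elims(9))

lemmas wp_simps = wp_Skip wp_Set wp_Pick wp_Move wp_Arith wp_Seq wp_If wp_Call

definition For :: "nat \<Rightarrow> nexp \<Rightarrow> com \<Rightarrow> com" where
  "For d e c = Seq (Set d (Num 0) (Num 0))
     (While (Less (Entry d (Num 0)) e)
       (Seq c (Set d (Num 0) (Plus (Entry d (Num 0)) (Num 1)))))"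

text \<open>
  The invariant must not look at the loop variable, which the assignment and the increment of the
  counter change; the body has to leave the counter alone. In nested loops the invariant of an inner
  loop carries the values of the outer counters.
\<close>

lemma wp_For:
  assumes bound: "\<And>D. nval I D e = N"
    and indep: "\<And>k s g. Inv k s \<Longrightarrow> Inv k (s\<lparr>dvars := (dvars s)(d := g)\<rparr>)"
    and step: "\<And>k s. k < N \<Longrightarrow> dvars s d 0 = k \<Longrightarrow> Inv k s \<Longrightarrow>
      wp I P c (\<lambda>t. dvars t d 0 = k \<and> Inv (Suc k) t) s"
    and init: "Inv 0 s"
    and final: "\<And>t. Inv N t \<Longrightarrow> Q t"
  shows "wp I P (For d e c) Q s"
proof -
  let ?inc = "Set d (Num 0) (Plus (Entry d (Num 0)) (Num 1))"
  let ?loop = "While (Less (Entry d (Num 0)) e) (Seq c ?inc)"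
  have loop: "wp I P ?loop Q s" if "Inv k s" "dvars s d 0 = k" "k \<le> N" for k s
    using that
  proof (induction "N - k" arbitrary: k s)
    case 0
    then have "exec I P ?loop s s"
      by (intro exec.WhileFalse) (simp add: bound)
    with 0 show ?case
      using final by (auto simp: wp_def)
  next
    case (Suc l)
    then have "k < N"
      by simp
    then obtain t where t: "exec I P c s t" "dvars t d 0 = k" "Inv (Suc k) t"
      using step[of k s] Suc.prems by (auto simp: wp_def)
    define u where "u = t\<lparr>dvars := (dvars t)(d := (dvars t d)(0 := Suc k))\<rparr>"
    have body: "exec I P (Seq c ?inc) s u"
      using exec.Set[of I P d "Num 0" "Plus (Entry d (Num 0)) (Num 1)" t] t
      by (auto intro: exec.Seq simp: u_def)
    have "wp I P ?loop Q u"
      using \<open>k < N\<close> Suc.hyps(2) t indep by (intro Suc.hyps(1)[of "Suc k"]) (auto simp: u_def)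
    then obtain v where "exec I P ?loop u v" "Q v"
      by (auto simp: wp_def)
    with body \<open>k < N\<close> Suc.prems(2) show ?case
      unfolding wp_def by (auto intro!: exec.WhileTrue[where s' = u] exI[of _ v] simp: bound)
  qed
  show ?thesis
    unfolding For_def wp_simps by (rule loop[of 0]) (use init indep in auto)
qed

section \<open>The recursive algorithm\<close>

text \<open>
  Variable \<open>0\<close> holds the multi-index \<open>\<alpha>\<close>, entry \<open>0\<close> of variable \<open>1\<close> holds \<open>m - i\<close>, and variable \<open>2\<close>
  is always the zero multi-index. Storing \<open>m - i\<close> instead of \<open>i\<close> makes the all-zero initial
  state the call for \<open>i = m\<close>, \<open>\<alpha> = 0\<close>, whose result is \<open>Q\<close>.

  A call leaves \<open>horner i \<alpha>\<close> in array \<open>0\<close> at \<open>\<alpha>\<close>. For \<open>i > 0\<close> the first inner call puts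
  \<open>horner (i - 1) \<alpha>\<close> there and the second one \<open>horner i (\<alpha> + e (i - 1))\<close> into a cell of its own. As a
  variable cannot be copied, the program moves \<open>\<alpha>\<close> up and down in coordinate \<open>i - 1\<close> in order to
  address both cells. Array \<open>1\<close> is a single scratch cell.
\<close>

definition horner_rec :: com where
  "horner_rec =
    (let axis = Minus Dim (Plus (Entry 1 (Num 0)) (Num 1)) in
     If (Less (Entry 1 (Num 0)) Dim)
       (Seq (Set 1 (Num 0) (Plus (Entry 1 (Num 0)) (Num 1)))
       (Seq Call
       (Seq (Set 1 (Num 0) (Minus (Entry 1 (Num 0)) (Num 1)))
       (Seq (Set 0 axis (Plus (Entry 0 axis) (Num 1)))
         (If (Member 0)
           (Seq Call
           (Seq (Set 0 axis (Minus (Entry 0 axis) (Num 1)))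
           (Seq (Arith 1 2 Sub (Point axis) (Node (Entry 0 axis) axis))
           (Seq (Set 0 axis (Plus (Entry 0 axis) (Num 1)))
           (Seq (Arith 1 2 Mul (Cell 1 2) (Cell 0 0))
           (Seq (Set 0 axis (Minus (Entry 0 axis) (Num 1)))
             (Arith 0 0 Add (Cell 0 0) (Cell 1 2))))))))
           Skip)))))
       (Move 0 0 (Coef 0)))"

lemma recursive_horner_rec: "recursive_alg horner_rec"
  by (simp add: recursive_alg_def horner_rec_def Let_def)

context newton_data
begin

text \<open>
  The second conjunct is the frame condition: in array \<open>0\<close> a call writes only at the
  indices that it sums over. It protects the result of the first inner call from the second one. The operation count is stated
  with \<open>3\<close> on the left to avoid truncated subtraction.
\<close>

definition rec_post :: "nat \<Rightarrow> mindex \<Rightarrow> state \<Rightarrow> state \<Rightarrow> bool" where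
  "rec_post i \<alpha> s t \<longleftrightarrow>
     mem t (0, \<alpha>) = val i \<alpha> \<and>
     (\<forall>\<beta>. \<beta> \<notin> upper A i \<alpha> \<longrightarrow> mem t (0, \<beta>) = mem s (0, \<beta>)) \<and>
     ops t + 3 \<le> ops s + 3 * card (upper A i \<alpha>) \<and>
     used t \<subseteq> used s \<union> {0} \<times> A \<union> {(1, \<lambda>_. 0)}"

text \<open>
  The induction measure decreases for both inner calls: the first one lowers \<open>i\<close> and sums over no
  more indices, the second one sums over fewer because \<open>\<alpha>\<close> itself is missing. The two index sets
  partition that of the outer call, so the bounds \<open>3 * card - 3\<close> of the inner calls and the three
  operations that combine them add up to the bound of the outer call.
\<close>

lemma wp_horner_rec:
  assumes "\<alpha> \<in> A" "i \<le> m"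
    and "dvars s 0 = \<alpha>" "dvars s 1 0 = m - i" "dvars s 2 = (\<lambda>_. 0)"
  shows "wp I horner_rec horner_rec (rec_post i \<alpha> s) s"
  using assms
proof (induction "card (upper A i \<alpha>) + i" arbitrary: i \<alpha> s rule: less_induct)
  case less
  \<comment> \<open>a second name for the program, so that only the outermost call gets unfolded\<close>
  define P where "P = horner_rec"
  note vars = less.prems(3-5)
  have "wp I P horner_rec (rec_post i \<alpha> s) s"
  proof (cases i)
    case 0
    then show ?thesis
      using less.prems by (auto simp: horner_rec_def Let_def wp_simps rec_post_def store_def upper_0 val_0)
  next
    case (Suc l)
    let ?\<beta> = "next_index l \<alpha>"
    have l: "l < m" "m - (m - l) = l" "Suc (m - Suc l) = m - l"
      using Suc less.prems(2) by auto
    have split: "upper A i \<alpha> = upper A l \<alpha> \<union> upper A i ?\<beta>"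
      using upper_Suc[of A l \<alpha>] Suc by simp
    have disj: "upper A l \<alpha> \<inter> upper A i ?\<beta> = {}"
      using upper_disjoint[of A l \<alpha>] Suc by simp
    have card: "card (upper A i \<alpha>) = card (upper A l \<alpha>) + card (upper A i ?\<beta>)"
      unfolding split by (rule card_Un_disjoint) (simp_all add: finite_upper disj)
    have first: "wp I P P (rec_post l \<alpha> u) u"
      if "dvars u 0 = \<alpha>" "dvars u 1 0 = m - l" "dvars u 2 = (\<lambda>_. 0)" for u
      unfolding P_def using less.prems l that card Suc by (intro less.hyps) auto
    have second: "wp I P P (rec_post i ?\<beta> u) u"
      if "?\<beta> \<in> A" "dvars u 0 = ?\<beta>" "dvars u 1 0 = m - i" "dvars u 2 = (\<lambda>_. 0)" for u
    proof -
      have "0 < card (upper A l \<alpha>)"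
        using upper_refl[OF less.prems(1)] by (auto simp: card_gt_0_iff finite_upper)
      then show ?thesis
        unfolding P_def using less.prems(2) that card by (intro less.hyps) auto
    qed
    show ?thesis
    proof (cases "?\<beta> \<in> A")
      case False
      then have "upper A i ?\<beta> = {}"
        using upper_next_empty[OF downward_closed less.prems(1) l(1)] Suc by simp
      with False show ?thesis
        using vars l Suc split val_Suc_last[OF less.prems(1) l(1)]
        by (auto simp: horner_rec_def Let_def wp_simps rec_post_def intro!: wp_mono[OF first])
    next
      case True
      have notin: "\<alpha> \<notin> upper A i ?\<beta>"
        using disj upper_refl[OF less.prems(1)] by blast
      \<comment> \<open>\<open>t\<close> and \<open>u\<close> are the states after the two inner calls, \<open>v\<close> the final state\<close>
      have combine: "rec_post i \<alpha> s v"
        if t: "mem t (0, \<alpha>) = val l \<alpha>"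
            "\<forall>\<beta>. \<beta> \<notin> upper A l \<alpha> \<longrightarrow> mem t (0, \<beta>) = mem s (0, \<beta>)"
            "ops t + 3 \<le> ops s + 3 * card (upper A l \<alpha>)"
            "used t \<subseteq> used s \<union> {0} \<times> A \<union> {(1, \<lambda>_. 0)}"
          and u: "mem u (0, ?\<beta>) = val i ?\<beta>"
            "\<forall>\<beta>. \<beta> \<notin> upper A i ?\<beta> \<longrightarrow> mem u (0, \<beta>) = mem t (0, \<beta>)"
            "ops u + 3 \<le> ops t + 3 * card (upper A i ?\<beta>)"
            "used u \<subseteq> used t \<union> {0} \<times> A \<union> {(1, \<lambda>_. 0)}"
          and v: "mem v (0, \<alpha>) = mem u (0, \<alpha>) + (pt I l - node I (\<alpha> l) l) * mem u (0, ?\<beta>)"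
            "\<forall>\<beta>. \<beta> \<noteq> \<alpha> \<longrightarrow> mem v (0, \<beta>) = mem u (0, \<beta>)"
            "ops v = ops u + 3" "used v \<subseteq> used u \<union> {0} \<times> A \<union> {(1, \<lambda>_. 0)}"
        for t u v :: state
      proof -
        have "mem v (0, \<alpha>) = val i \<alpha>"
          using t(1) u(1,2) v(1) notin Suc by (simp add: val_Suc[of l \<alpha>])
        moreover have "mem v (0, \<beta>) = mem s (0, \<beta>)" if "\<beta> \<notin> upper A i \<alpha>" for \<beta>
        proof -
          have "\<beta> \<noteq> \<alpha>"
            using that upper_refl[OF less.prems(1)] by blast
          with that show ?thesis
            using t(2) u(2) v(2) by (simp add: split)
        qed
        moreover have "used v \<subseteq> used s \<union> {0} \<times> A \<union> {(1, \<lambda>_. 0)}"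
          using t(4) u(4) v(4) by blast
        ultimately show ?thesis
          using t(3) u(3) v(3) card by (simp add: rec_post_def)
      qed
      show ?thesis
        using vars l Suc True
        apply (simp add: horner_rec_def Let_def wp_simps store_def)
        apply (rule wp_mono[OF first])
           apply simp_all
        apply (rule wp_mono[OF second])
            apply simp_all
        subgoal for t u
          by (rule combine[of t u, unfolded Suc]) (use less.prems(1) in \<open>auto simp: rec_post_def\<close>)
        done
    qed
  qed
  then show ?case
    by (simp add: P_def)
qed

end

section \<open>The iterative algorithm\<close>

text \<open>
  The variables of the iterative program: entry \<open>0\<close> of variables \<open>0\<close>, \<open>3\<close>, \<open>4\<close> and \<open>5\<close> holds the
  coordinate \<open>j\<close> of differentiation, the current coordinate \<open>i\<close>, the level counter and the position
  in the enumeration; variable \<open>1\<close> holds \<open>\<alpha>\<close>, variable \<open>2\<close> holds \<open>\<alpha> + e i\<close>, and variable \<open>6\<close> is the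
  zero multi-index. Array \<open>0\<close> is the table of derivatives, array \<open>1\<close> that of values, and arrays
  \<open>2\<close> and \<open>3\<close> are scratch cells.
\<close>

definition horner_update :: com where
  "horner_update =
    (let j = Entry 0 (Num 0); i = Entry 3 (Num 0) in
     Seq (Arith 2 6 Sub (Point i) (Node (Entry 1 i) i))
    (Seq (Arith 3 6 Mul (Cell 2 6) (Cell 0 2))
    (Seq (Arith 0 1 Add (Cell 0 1) (Cell 3 6))
    (Seq (If (And (Not (Less i j)) (Not (Less j i))) (Arith 0 1 Add (Cell 0 1) (Cell 1 2)) Skip)
    (Seq (Arith 3 6 Mul (Cell 2 6) (Cell 1 2))
         (Arith 1 1 Add (Cell 1 1) (Cell 3 6)))))))"

text \<open>
  Level \<open>u\<close> consists of the \<open>\<alpha>\<close> with \<open>\<alpha> i + u + 1 = card A\<close>: counting \<open>u\<close> upwards visits the entries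
  \<open>\<alpha> i\<close> in decreasing order.
\<close>

definition horner_step :: com where
  "horner_step =
    (let i = Entry 3 (Num 0);
         level = Plus (Entry 1 i) (Plus (Entry 4 (Num 0)) (Num 1)) in
     Seq (Pick 1 (Entry 5 (Num 0)))
    (Seq (Pick 2 (Entry 5 (Num 0)))
    (Seq (Set 2 i (Plus (Entry 2 i) (Num 1)))
         (If (And (Member 2) (And (Not (Less level Card)) (Not (Less Card level))))
           horner_update Skip))))"

definition horner_iter :: com where
  "horner_iter =
     Seq (For 5 Card
           (Seq (Pick 1 (Entry 5 (Num 0)))
           (Seq (Move 0 1 (Lit 0)) (Move 1 1 (Coef 1)))))
         (For 3 Dim (For 4 Card (For 5 Card horner_step)))"

lemma iterative_horner_iter: "iterative_alg horner_iter"
  by (simp add: iterative_alg_def horner_iter_def For_def horner_step_def horner_update_def Let_def)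

context newton_data
begin

text \<open>
  A bound on the price of one update. It is \<open>0\<close> if the maximal degree is, since then
  no update takes place.
\<close>

definition unit_cost :: nat where
  "unit_cost = 6 * min 1 (max_degree m A)"

text \<open>
  The invariant of a sweep in coordinate \<open>i\<close>: the table entries in \<open>S\<close> already belong to \<open>i + 1\<close>, the
  others still to \<open>i\<close>, and earlier sweeps have paid at most once for every element of \<open>A\<close>.
\<close>

definition swept :: "nat \<Rightarrow> nat \<Rightarrow> mindex set \<Rightarrow> state \<Rightarrow> bool" where
  "swept j i S s \<longleftrightarrow>
     (\<forall>\<alpha>\<in>A. mem s (0, \<alpha>) = slope j (if \<alpha> \<in> S then Suc i else i) \<alpha> \<and>
            mem s (1, \<alpha>) = val (if \<alpha> \<in> S then Suc i else i) \<alpha>) \<and>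
     ops s \<le> unit_cost * (i * card A + card S) \<and>
     used s \<subseteq> {0, 1} \<times> A \<union> {2, 3} \<times> {\<lambda>_. 0} \<and>
     dvars s 0 0 = j \<and> dvars s 6 = (\<lambda>_. 0)"

text \<open>
  The indices that are finished when the sweep has reached position \<open>k\<close> of the enumeration on level
  \<open>u\<close>: all those on earlier levels, and those on the current level that have been enumerated.
\<close>

definition settled :: "nat \<Rightarrow> nat \<Rightarrow> nat \<Rightarrow> mindex set" where
  "settled i u k = {\<alpha> \<in> A. card A < \<alpha> i + Suc u \<or>
     \<alpha> i + Suc u = card A \<and> \<alpha> \<in> set (take k (idx I))}"

lemma max_degree_ge:
  assumes "\<alpha> \<in> A" "i < m"
  shows "\<alpha> i \<le> max_degree m A"
proof -
  have "finite {\<alpha> i | \<alpha> i. \<alpha> \<in> A \<and> i < m}"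
    by (rule finite_subset[of _ "(\<lambda>(\<alpha>, i). \<alpha> i) ` (A \<times> {..<m})"]) auto
  then show ?thesis
    unfolding max_degree_def using assms by (intro Max_ge) auto
qed

lemma swept_other_vars:
  assumes "d \<noteq> 0" "d \<noteq> 6"
  shows "swept j i S (s\<lparr>dvars := (dvars s)(d := g)\<rparr>) \<longleftrightarrow> swept j i S s"
  using assms by (simp add: swept_def)

lemma wp_horner_update:
  assumes \<alpha>: "\<alpha> \<in> A" "\<alpha> \<notin> S" and nxt: "next_index i \<alpha> \<in> A" "next_index i \<alpha> \<in> S"
    and i: "i < m" and S: "S \<subseteq> A"
    and vars: "dvars s 1 = \<alpha>" "dvars s 2 = next_index i \<alpha>" "dvars s 3 0 = i"
    and s: "swept j i S s"
  shows "wp I P horner_update (\<lambda>t. dvars t = dvars s \<and> swept j i (insert \<alpha> S) t) s"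
proof -
  have "1 \<le> next_index i \<alpha> i"
    by simp
  then have one: "unit_cost = 6"
    using max_degree_ge[OF nxt(1) i] unfolding unit_cost_def by linarith
  have card: "card (insert \<alpha> S) = Suc (card S)"
    using \<alpha>(2) S finite_subset[OF S] by simp
  have ne: "next_index i \<alpha> \<noteq> \<alpha>" "\<alpha> \<noteq> next_index i \<alpha>"
    using \<alpha>(2) nxt(2) by auto
  note tables = s[unfolded swept_def, THEN conjunct1, rule_format]
  have "dvars s 0 0 = j" "dvars s 6 = (\<lambda>_. 0)"
    using s by (simp_all add: swept_def)
  with tables[OF \<alpha>(1)] tables[OF nxt(1)] s show ?thesis
    using \<alpha> nxt vars card one ne
    by (auto simp: horner_update_def Let_def wp_simps store_def swept_def val_Suc[of i \<alpha>]
        slope_Suc[of j i \<alpha>])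
qed

lemma settled_next:
  assumes "k < card A"
  shows "settled i u (Suc k) =
    (if (idx I ! k) i + Suc u = card A then insert (idx I ! k) (settled i u k) else settled i u k)"
  using assms nth_mem[of k "idx I"] by (auto simp: settled_def card_A take_Suc_conv_app_nth)

lemma settled_all: "settled i u (card A) = settled i (Suc u) 0"
  by (auto simp: settled_def card_A)

lemma settled_none: "i < m \<Longrightarrow> settled i 0 0 = {}"
  using entry_less_card[OF downward_closed] by (fastforce simp: settled_def)

lemma settled_end: "settled i (card A) 0 = A"
  by (auto simp: settled_def)

text \<open>
  No index is processed twice, because the enumeration is free of repetitions; each update is
  therefore paid for by a new element of the settled set.
\<close>

lemma nth_not_settled:
  assumes "k < card A" "(idx I ! k) i + Suc u = card A"
  shows "idx I ! k \<notin> settled i u k"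
proof -
  have "idx I ! k \<notin> set (take k (idx I))"
    using assms(1) distinct by (auto simp: in_set_conv_nth nth_eq_iff_index_eq card_A)
  with assms(2) show ?thesis
    by (simp add: settled_def)
qed

text \<open>
  The end of one sweep is the start of the next.
\<close>

lemma swept_all: "swept j i A s \<longleftrightarrow> swept j (Suc i) {} s"
  by (simp add: swept_def add.commute)

text \<open>
  If \<open>\<alpha> + e i\<close> lies outside \<open>A\<close>, the recurrence has no second summand, so the old table
  entries at \<open>\<alpha>\<close> are already the new ones.
\<close>

lemma swept_insert_last:
  assumes "swept j i S s" "S \<subseteq> A" "\<alpha> \<in> A" "i < m" "next_index i \<alpha> \<notin> A"
  shows "swept j i (insert \<alpha> S) s"
proof -
  have le: "unit_cost * (i * card A + card S) \<le>
      unit_cost * (i * card A + card (insert \<alpha> S))"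
    using finite_subset[OF assms(2)] by (intro mult_left_mono add_left_mono card_mono) auto
  then show ?thesis
    using assms val_Suc_last[OF assms(3-5)] slope_Suc_last[OF assms(3-5)]
    by (auto simp: swept_def intro: order_trans[OF _ le])
qed

lemma wp_horner_step:
  assumes i: "i < m" and k: "k < card A"
    and vars: "dvars s 3 0 = i" "dvars s 4 0 = u" "dvars s 5 0 = k"
    and s: "swept j i (settled i u k) s"
  shows "wp I P horner_step (\<lambda>t. dvars t 3 0 = i \<and> dvars t 4 0 = u \<and> dvars t 5 0 = k \<and>
    swept j i (settled i u (Suc k)) t) s"
proof -
  let ?\<alpha> = "idx I ! k"
  let ?t = "s\<lparr>dvars := (dvars s)(1 := ?\<alpha>, 2 := next_index i ?\<alpha>)\<rparr>"
  have \<alpha>: "?\<alpha> \<in> A"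
    using k by (simp add: card_A)
  have sub: "settled i u k \<subseteq> A"
    by (auto simp: settled_def)
  have t: "swept j i (settled i u k) ?t"
    using s by (simp add: swept_def)
  show ?thesis
  proof (cases "next_index i ?\<alpha> \<in> A \<and> ?\<alpha> i + Suc u = card A")
    case True
    then have "next_index i ?\<alpha> \<in> settled i u k"
      by (simp add: settled_def)
    then have "wp I P horner_update
        (\<lambda>t'. dvars t' = dvars ?t \<and> swept j i (insert ?\<alpha> (settled i u k)) t') ?t"
      using True \<alpha> vars by (intro wp_horner_update[OF _ nth_not_settled[OF k] _ _ i sub _ _ _ t]) auto
    then have "wp I P horner_update (\<lambda>t'. dvars t' 3 0 = i \<and> dvars t' 4 0 = u \<and>
        dvars t' 5 0 = k \<and> swept j i (settled i u (Suc k)) t') ?t"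
      by (rule wp_mono) (use True vars in \<open>simp add: settled_next[OF k]\<close>)
    then show ?thesis
      using True k vars by (simp add: horner_step_def Let_def wp_simps card_A)
  next
    case False
    then have "swept j i (settled i u (Suc k)) ?t"
      using t swept_insert_last[OF t sub \<alpha> i] by (auto simp: settled_next[OF k])
    then show ?thesis
      using False k vars by (auto simp: horner_step_def Let_def wp_simps card_A)
  qed
qed

lemma wp_horner_iter:
  assumes vars: "dvars s 0 0 = j" "dvars s 6 = (\<lambda>_. 0)" and s: "ops s = 0" "used s = {}"
  shows "wp I P horner_iter (swept j m {}) s"
proof -
  let ?init = "\<lambda>k (s :: state). (\<forall>\<alpha>\<in>set (take k (idx I)). mem s (0, \<alpha>) = 0 \<and> mem s (1, \<alpha>) = coef I \<alpha>) \<and>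
     ops s = 0 \<and> used s \<subseteq> {0, 1} \<times> A \<and> dvars s 0 0 = j \<and> dvars s 6 = (\<lambda>_. 0)"
  have rows: "wp I P (For 5 Card horner_step)
      (\<lambda>t. dvars t 3 0 = i \<and> dvars t 4 0 = u \<and> swept j i (settled i (Suc u) 0) t) s"
    if "i < m" "dvars s 3 0 = i" "dvars s 4 0 = u" "swept j i (settled i u 0) s" for i u s
    by (rule wp_For[where N = "card A" and
          Inv = "\<lambda>k t. dvars t 3 0 = i \<and> dvars t 4 0 = u \<and> swept j i (settled i u k) t"])
      (use that in \<open>auto simp: card_A swept_other_vars settled_all[unfolded card_A]
          intro!: wp_mono[OF wp_horner_step]\<close>)
  have levels: "wp I P (For 4 Card (For 5 Card horner_step))
      (\<lambda>t. dvars t 3 0 = i \<and> swept j (Suc i) {} t) s"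
    if "i < m" "dvars s 3 0 = i" "swept j i {} s" for i s
    by (rule wp_For[where N = "card A" and
          Inv = "\<lambda>u t. dvars t 3 0 = i \<and> swept j i (settled i u 0) t"])
      (use that in \<open>auto simp: card_A swept_other_vars settled_none settled_end[unfolded card_A]
          swept_all[unfolded card_A] intro!: wp_mono[OF rows]\<close>)
  have axes: "wp I P (For 3 Dim (For 4 Card (For 5 Card horner_step))) (swept j m {}) s"
    if "swept j 0 {} s" for s
    by (rule wp_For[where N = m and Inv = "\<lambda>i. swept j i {}"])
      (use that in \<open>auto simp: swept_other_vars intro!: wp_mono[OF levels]\<close>)
  show ?thesis
    unfolding horner_iter_def wp_Seq[of _ _ "For 5 _ _"]
  proof (rule wp_For[where N = "card A" and Inv = ?init])
    fix t :: state
    assume "?init (card A) t"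
    then have "swept j 0 {} t"
      by (auto simp: swept_def card_A val_0 slope_0)
    then show "wp I P (For 3 Dim (For 4 Card (For 5 Card horner_step))) (swept j m {}) t"
      by (rule axes)
  qed (use vars s in \<open>auto simp: card_A wp_simps store_def take_Suc_conv_app_nth\<close>)
qed

end

section \<open>Operation counts and storage\<close>

text \<open>
  A number of arrays over \<open>B\<close> and a number of scratch cells; as \<open>B\<close> is nonempty, each scratch cell
  costs no more than an array.
\<close>

lemma card_cells_le:
  assumes "finite B" "B \<noteq> {}" "finite T" "U \<subseteq> C \<times> B \<union> T" "finite C"
  shows "card U \<le> (card C + card T) * card B"
proof -
  have "card U \<le> card (C \<times> B) + card T"
    using assms by (meson card_Un_le card_mono finite_SigmaI finite_UnI le_trans)
  also have "\<dots> \<le> (card C + card T) * card B"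
    using assms(1,2) by (simp add: card_cartesian_product algebra_simps Suc_le_eq card_gt_0_iff)
  finally show ?thesis .
qed

lemma computes_within_wp:
  assumes "\<And>M. wp I P P
    (\<lambda>t. mem t (0, \<lambda>_. 0) = y \<and> ops t \<le> T \<and> card (used t) \<le> S) (start args M)"
  shows "computes_within P I args y T S"
  using assms unfolding computes_within_def wp_def by blast

lemma computes_within_mono:
  assumes "computes_within P I args y T S" "T \<le> T'" "S \<le> S'"
  shows "computes_within P I args y T' S'"
  using assms unfolding computes_within_def by (meson order_trans)

context newton_data
begin

lemma computes_within_horner_rec:
  "computes_within horner_rec I [] (val m (\<lambda>_. 0)) (3 * card A) (2 * card A)"
proof (rule computes_within_wp)
  fix M
  let ?s = "start [] M"
  have "wp I horner_rec horner_rec (rec_post m (\<lambda>_. 0) ?s) ?s"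
    by (rule wp_horner_rec[OF zero_index]) (simp_all add: start_def)
  then show "wp I horner_rec horner_rec
      (\<lambda>t. mem t (0, \<lambda>_. 0) = val m (\<lambda>_. 0) \<and> ops t \<le> 3 * card A \<and> card (used t) \<le> 2 * card A) ?s"
  proof (rule wp_mono)
    fix t
    assume t: "rec_post m (\<lambda>_. 0) ?s t"
    then have "used t \<subseteq> {0} \<times> A \<union> {(1, \<lambda>_. 0)}"
      by (simp add: rec_post_def start_def)
    then have "card (used t) \<le> (card {0 :: nat} + card {(1 :: nat, \<lambda>_ :: nat. 0 :: nat)}) * card A"
      using nonempty by (intro card_cells_le) auto
    with t show "mem t (0, \<lambda>_. 0) = val m (\<lambda>_. 0) \<and> ops t \<le> 3 * card A \<and> card (used t) \<le> 2 * card A"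
      by (simp add: rec_post_def start_def upper_all[OF downward_closed])
  qed
qed

text \<open>
  The set \<open>U\<close> leaves room for one more write to the table of derivatives after the sweeps.
\<close>

lemma swept_storage:
  assumes "swept j i S t" "U \<subseteq> used t \<union> {0} \<times> A"
  shows "card U \<le> 4 * card A"
proof -
  have "used t \<subseteq> {0, 1} \<times> A \<union> {2, 3} \<times> {\<lambda>_. 0}"
    using assms(1) by (simp add: swept_def)
  with assms(2) have "U \<subseteq> {0, 1} \<times> A \<union> {2, 3} \<times> {\<lambda>_. 0}"
    by blast
  then have "card U \<le> (card {0, 1 :: nat} + card ({2, 3 :: nat} \<times> {\<lambda>_ :: nat. 0 :: nat})) * card A"
    using nonempty by (intro card_cells_le) auto
  then show ?thesis
    by (simp add: card_cartesian_product)
qed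

lemma swept_result:
  assumes "swept j m {} t"
  shows "mem t (0, \<lambda>_. 0) = slope j m (\<lambda>_. 0)" "mem t (1, \<lambda>_. 0) = val m (\<lambda>_. 0)"
    "ops t \<le> unit_cost * (m * card A)"
  using assms zero_index by (auto simp: swept_def)

lemma computes_within_horner_iter:
  "computes_within horner_iter I [j] (slope j m (\<lambda>_. 0))
    (6 * (max_degree m A * m * card A)) (4 * card A)"
proof (rule computes_within_wp)
  fix M
  have cost: "unit_cost * (m * card A) \<le> 6 * (max_degree m A * m * card A)"
    by (simp add: unit_cost_def)
  have "wp I horner_iter horner_iter (swept j m {}) (start [j] M)"
    by (rule wp_horner_iter) (simp_all add: start_def)
  then show "wp I horner_iter horner_iter (\<lambda>t. mem t (0, \<lambda>_. 0) = slope j m (\<lambda>_. 0) \<and>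
      ops t \<le> 6 * (max_degree m A * m * card A) \<and> card (used t) \<le> 4 * card A) (start [j] M)"
    by (rule wp_mono) (use swept_result swept_storage order_trans[OF swept_result(3) cost] in auto)
qed

text \<open>
  Without arguments the program differentiates in coordinate \<open>0\<close>. The value of \<open>Q\<close> is then
  copied over that derivative, into the output cell, at no arithmetic cost.
\<close>

lemma computes_within_horner_iter_value:
  defines "P \<equiv> Seq horner_iter (Move 0 6 (Cell 1 6))"
  shows "computes_within P I [] (val m (\<lambda>_. 0)) (6 * (m * card A)) (4 * card A)"
proof (rule computes_within_wp)
  fix M
  have cost: "unit_cost * (m * card A) \<le> 6 * (m * card A)"
    by (simp add: unit_cost_def)
  have "wp I P horner_iter (swept 0 m {}) (start [] M)"
    by (rule wp_horner_iter) (simp_all add: start_def)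
  then have "wp I P horner_iter (wp I P (Move 0 6 (Cell 1 6))
      (\<lambda>t. mem t (0, \<lambda>_. 0) = val m (\<lambda>_. 0) \<and> ops t \<le> 6 * (m * card A) \<and> card (used t) \<le> 4 * card A))
    (start [] M)"
  proof (rule wp_mono)
    fix t
    assume t: "swept 0 m {} t"
    then have "dvars t 6 = (\<lambda>_. 0)"
      by (simp add: swept_def)
    moreover have "card (insert (0, \<lambda>_. 0) (used t)) \<le> 4 * card A"
      by (rule swept_storage[OF t]) (use zero_index in auto)
    ultimately show "wp I P (Move 0 6 (Cell 1 6)) (\<lambda>t. mem t (0, \<lambda>_. 0) = val m (\<lambda>_. 0) \<and>
        ops t \<le> 6 * (m * card A) \<and> card (used t) \<le> 4 * card A) t"
      using swept_result(2)[OF t] order_trans[OF swept_result(3)[OF t] cost]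
        by (simp add: wp_simps store_def)
  qed
  then show "wp I P P
      (\<lambda>t. mem t (0, \<lambda>_. 0) = val m (\<lambda>_. 0) \<and> ops t \<le> 6 * (m * card A) \<and> card (used t) \<le> 4 * card A)
      (start [] M)"
    by (simp add: P_def wp_Seq)
qed

end

lemma newton_data_of_input:
  assumes "newton_setting m A ns p" "newton_form m A p c Q" "newton_input m A p c x0 I"
  shows "newton_data I" "dim I = m" "set (idx I) = A"
    "Q x0 = newton_data.val I m (\<lambda>_. 0)" "partial_deriv j Q x0 = newton_data.slope I j m (\<lambda>_. 0)"
proof -
  obtain as where I: "distinct as" "set as = A" "I = \<lparr>dim = m, idx = as, node = p, coef = c, pt = x0\<rparr>"
    using assms(3) by (auto simp: newton_input_def)
  have A: "downward_closed m A" "A \<noteq> {}"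
    using assms(1) by (simp_all add: newton_setting_def)
  show data: "newton_data I"
    using I A by unfold_locales auto
  show "dim I = m" "set (idx I) = A"
    using I by simp_all
  show "Q x0 = newton_data.val I m (\<lambda>_. 0)" "partial_deriv j Q x0 = newton_data.slope I j m (\<lambda>_. 0)"
    unfolding newton_data.val_def[OF data] newton_data.slope_def[OF data]
    using I horner_eq_newton_form[OF A(1) assms(2)] by simp_all
qed

theorem theorem6:
  shows
    "(\<exists>P C. recursive_alg P \<and>
       (\<forall>m A ns p c Q x0 I.
          newton_setting m A ns p \<longrightarrow> newton_form m A p c Q \<longrightarrow> newton_input m A p c x0 I \<longrightarrow>
          computes_within P I [] (Q x0) (C * card A) (C * card A)))
   \<and> (\<exists>P C. iterative_alg P \<and>
       (\<forall>m A ns p c Q x0 I.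
          newton_setting m A ns p \<longrightarrow> newton_form m A p c Q \<longrightarrow> newton_input m A p c x0 I \<longrightarrow>
          computes_within P I [] (Q x0) (C * (m * card A)) (C * card A)))
   \<and> (\<exists>P C. iterative_alg P \<and>
       (\<forall>m A ns p c Q x0 I. \<forall>j<m.
          newton_setting m A ns p \<longrightarrow> newton_form m A p c Q \<longrightarrow> newton_input m A p c x0 I \<longrightarrow>
          computes_within P I [j] (partial_deriv j Q x0)
            (C * (max_degree m A * m * card A)) (C * card A)))"
proof (intro conjI)
  show "\<exists>P C. recursive_alg P \<and>
       (\<forall>m A ns p c Q x0 I.
          newton_setting m A ns p \<longrightarrow> newton_form m A p c Q \<longrightarrow> newton_input m A p c x0 I \<longrightarrow>
          computes_within P I [] (Q x0) (C * card A) (C * card A))"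
  proof (intro exI conjI allI impI)
    fix m A ns p c Q x0 I
    assume "newton_setting m A ns p" "newton_form m A p c Q" "newton_input m A p c x0 I"
    note problem = newton_data_of_input[OF this]
    show "computes_within horner_rec I [] (Q x0) (3 * card A) (3 * card A)"
      using newton_data.computes_within_horner_rec[OF problem(1)]
      unfolding problem(2-4) by (rule computes_within_mono) simp_all
  qed (rule recursive_horner_rec)
next
  show "\<exists>P C. iterative_alg P \<and>
       (\<forall>m A ns p c Q x0 I.
          newton_setting m A ns p \<longrightarrow> newton_form m A p c Q \<longrightarrow> newton_input m A p c x0 I \<longrightarrow>
          computes_within P I [] (Q x0) (C * (m * card A)) (C * card A))"
  proof (intro exI conjI allI impI)
    fix m A ns p c Q x0 I
    assume "newton_setting m A ns p" "newton_form m A p c Q" "newton_input m A p c x0 I"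
    note problem = newton_data_of_input[OF this]
    show "computes_within (Seq horner_iter (Move 0 6 (Cell 1 6))) I [] (Q x0)
        (6 * (m * card A)) (6 * card A)"
      using newton_data.computes_within_horner_iter_value[OF problem(1)]
      unfolding problem(2-4) by (rule computes_within_mono) simp_all
  qed (use iterative_horner_iter in \<open>simp add: iterative_alg_def\<close>)
next
  show "\<exists>P C. iterative_alg P \<and>
       (\<forall>m A ns p c Q x0 I. \<forall>j<m.
          newton_setting m A ns p \<longrightarrow> newton_form m A p c Q \<longrightarrow> newton_input m A p c x0 I \<longrightarrow>
          computes_within P I [j] (partial_deriv j Q x0)
            (C * (max_degree m A * m * card A)) (C * card A))"
  proof (intro exI conjI allI impI)
    fix m A ns p c Q x0 I j
    assume "newton_setting m A ns p" "newton_form m A p c Q" "newton_input m A p c x0 I"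
    note problem = newton_data_of_input[OF this]
    show "computes_within horner_iter I [j] (partial_deriv j Q x0)
        (6 * (max_degree m A * m * card A)) (6 * card A)"
      using newton_data.computes_within_horner_iter[OF problem(1), of j]
      unfolding problem(2,3) problem(5)[symmetric] by (rule computes_within_mono) simp_all
  qed (rule iterative_horner_iter)
qed

end
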